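(* Let $F=(F,\mathcal G_0,\nu)$ be a supertropical semifield with tangible elements $\mathcal T$, let $v\in F^{(n)}$, let $S=\{w_1,\dots,w_\ell\}\subset F^{(n)}$ be a tropically independent set, and let $\alpha_1,\dots,\alpha_\ell\in\mathcal T$ be such that $$v+\sum_{i=1}^\ell \alpha_i w_i\in\mathcal G_0^{(n)}$$ is an irredundant tropical dependence. Then this dependence can be increased to a saturated tropical dependence of $v$ on $S$ having the same support, and this saturated dependence is unique up to equivalence. That is: there are $\alpha_1',\dots,\alpha_\ell'\in\mathcal T$ with $\alpha_i\le_\nu\alpha_i'$ for all $i$ such that $v+\sum_{i=1}^\ell\alpha_i'w_i\in\mathcal G_0^{(n)}$ is a saturated tropical dependence of $v$ on $S$; and if $v+\sum_{i=1}^\ell\alpha_i''w_i\in\mathcal G_0^{(n)}$ is also a saturated tropical dependence of $v$ on $S$, then $\alpha_i''\equiv\alpha_i'$ for all $i$.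
   Context: A semiring with ghosts is a triple $(R,\mathcal G_0,\nu)$ where $R$ is a semiring with $0,1$ such that $R\setminus\{0\}$ is closed under addition and multiplication, $\mathcal G_0\ni 0$ is an ideal (the ghost ideal), and $\nu:R\to\mathcal G_0$, $\nu(a)=a+a=:a^\nu$, is idempotent and preserves addition and multiplication. Put $\mathcal G=\mathcal G_0\setminus\{0\}$. It is a supertropical semiring if for nonzero $a,b$: $a+b=a^\nu$ whenever $a^\nu=b^\nu$, and $a+b\in\{a,b\}$ whenever $a^\nu\neq b^\nu$; then $\mathcal G_0$ is totally ordered by $a^\nu\le b^\nu\iff a^\nu+b^\nu=b^\nu$. It is a supertropical domain if $\mathcal T:=R\setminus\mathcal G_0$ (the tangible elements) is a multiplicative monoid and $\nu|_{\mathcal T}:\mathcal T\to\mathcal G$ is onto, and a supertropical semifield if moreover $\mathcal T$ is a group. Put $\mathcal T_0=\mathcal T\cup\{0\}$. Write $a\ge_\nu b$ (resp. $a\cong_\nu b$) if $a^\nu\ge b^\nu$ (resp. $a^\nu=b^\nu$). Write $a\equiv b$ if $a=b$ or if $a,b\in\mathcal T$ and $a\cong_\nu b$. $F^{(n)}$ is the space of $n$-tuples with componentwise operations and ghost submodule $\mathcal G_0^{(n)}$. A set is tropically dependent if for some nonempty finite collection of its distinct elements $w_i$ ($i\in I'$) and some $\alpha_i\in\mathcal T$, $\sum_{i\in I'}\alpha_iw_i\in\mathcal G_0^{(n)}$; otherwise it is tropically independent. A tropical dependence of $v$ on $S=\{w_1,\dots,w_\ell\}$ is a relation $\alpha v+\sum_i\alpha_iw_i\in\mathcal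 G_0^{(n)}$ with $\alpha\in\mathcal T$, $\alpha_i\in\mathcal T_0$; its support is $\{i:\alpha_i\neq0\}$, and it is irredundant if its support is minimal (under inclusion) among supports of tropical dependences of $v$ on $S$. For $S$ tropically independent, a tropical dependence $v+\sum_i\alpha_iw_i\in\mathcal G_0^{(n)}$ ($\alpha_i\in\mathcal T_0$) is saturated if whenever $v+\sum_i\beta_iw_i\in\mathcal G_0^{(n)}$ with all $\beta_i\in\mathcal T_0$, then $\beta_i\le_\nu\alpha_i$ for every $i$. *)

theory Defs
  imports "HOL-Analysis.Finite_Cartesian_Product"
begin

text \<open>
  The semiring is the whole type \<open>'a\<close>. Multiplication is not assumed commutative. The class
  \<^class>\<open>semiring_1\<close> includes \<open>0 \<noteq> 1\<close>; this is no restriction for supertropical domains,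
  whose tangible elements form a monoid and hence are nonempty.
\<close>

locale semiring_with_ghosts =
  fixes G0 :: "'a::semiring_1 set" and \<nu> :: "'a \<Rightarrow> 'a"
  assumes add_nonzero: "a \<noteq> 0 \<Longrightarrow> b \<noteq> 0 \<Longrightarrow> a + b \<noteq> 0"
    and mult_nonzero: "a \<noteq> 0 \<Longrightarrow> b \<noteq> 0 \<Longrightarrow> a * b \<noteq> 0"
    and zero_ghost: "0 \<in> G0"
    and add_ghost: "a \<in> G0 \<Longrightarrow> b \<in> G0 \<Longrightarrow> a + b \<in> G0"
    and mult_ghost_left: "a \<in> G0 \<Longrightarrow> r * a \<in> G0"
    and mult_ghost_right: "a \<in> G0 \<Longrightarrow> a * r \<in> G0"
    and nu_eq: "\<nu> a = a + a"
    and nu_ghost: "\<nu> a \<in> G0"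
    and nu_idem: "\<nu> (\<nu> a) = \<nu> a"
    and nu_add: "\<nu> (a + b) = \<nu> a + \<nu> b"
    and nu_mult: "\<nu> (a * b) = \<nu> a * \<nu> b"

locale supertropical_semiring = semiring_with_ghosts +
  assumes add_nu_eq: "a \<noteq> 0 \<Longrightarrow> b \<noteq> 0 \<Longrightarrow> \<nu> a = \<nu> b \<Longrightarrow> a + b = \<nu> a"
    and add_nu_neq: "a \<noteq> 0 \<Longrightarrow> b \<noteq> 0 \<Longrightarrow> \<nu> a \<noteq> \<nu> b \<Longrightarrow> a + b \<in> {a, b}"

definition tangibles :: "'a set \<Rightarrow> 'a set" where
  "tangibles G0 = UNIV - G0"

definition tangibles0 :: "'a::zero set \<Rightarrow> 'a set" where
  "tangibles0 G0 = insert 0 (tangibles G0)"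

locale supertropical_domain = supertropical_semiring +
  assumes one_tangible: "1 \<in> tangibles G0"
    and mult_tangible: "a \<in> tangibles G0 \<Longrightarrow> b \<in> tangibles G0 \<Longrightarrow> a * b \<in> tangibles G0"
    and nu_onto: "\<nu> ` tangibles G0 = G0 - {0}"

locale supertropical_semifield = supertropical_domain +
  assumes tangible_inverse:
    "a \<in> tangibles G0 \<Longrightarrow> \<exists>b\<in>tangibles G0. a * b = 1 \<and> b * a = 1"

definition nu_le :: "('a::plus \<Rightarrow> 'a) \<Rightarrow> 'a \<Rightarrow> 'a \<Rightarrow> bool" where
  "nu_le \<nu> a b \<longleftrightarrow> \<nu> a + \<nu> b = \<nu> b"

definition tropical_equiv :: "'a set \<Rightarrow> ('a \<Rightarrow> 'a) \<Rightarrow> 'a \<Rightarrow> 'a \<Rightarrow> bool" where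
  "tropical_equiv G0 \<nu> a b \<longleftrightarrow>
     a = b \<or> (a \<in> tangibles G0 \<and> b \<in> tangibles G0 \<and> \<nu> a = \<nu> b)"

definition ghost_vectors :: "'a set \<Rightarrow> ('a ^ 'n) set" where
  "ghost_vectors G0 = {x. \<forall>j. x $ j \<in> G0}"

definition tropically_dependent :: "'a::semiring_1 set \<Rightarrow> ('a ^ 'n) set \<Rightarrow> bool" where
  "tropically_dependent G0 A \<longleftrightarrow>
     (\<exists>B \<alpha>. B \<subseteq> A \<and> finite B \<and> B \<noteq> {} \<and> (\<forall>u\<in>B. \<alpha> u \<in> tangibles G0)
        \<and> (\<Sum>u\<in>B. \<alpha> u *s u) \<in> ghost_vectors G0)"

abbreviation tropically_independent :: "'a::semiring_1 set \<Rightarrow> ('a ^ 'n) set \<Rightarrow> bool" where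
  "tropically_independent G0 A \<equiv> \<not> tropically_dependent G0 A"

text \<open>
  In the following the set \<open>S\<close> is given by its enumeration \<open>w 1, \<dots>, w l\<close>, and \<open>a\<close> is the
  coefficient of \<open>v\<close>. Values of \<open>w\<close> and \<open>\<alpha>\<close> outside \<open>{1..l}\<close> are irrelevant.
\<close>

definition tropical_dependence ::
  "'a::semiring_1 set \<Rightarrow> nat \<Rightarrow> (nat \<Rightarrow> 'a ^ 'n) \<Rightarrow> 'a ^ 'n \<Rightarrow> 'a \<Rightarrow> (nat \<Rightarrow> 'a) \<Rightarrow> bool" where
  "tropical_dependence G0 l w v a \<alpha> \<longleftrightarrow>
     a \<in> tangibles G0 \<and> (\<forall>i\<in>{1..l}. \<alpha> i \<in> tangibles0 G0)
     \<and> a *s v + (\<Sum>i=1..l. \<alpha> i *s w i) \<in> ghost_vectors G0"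

definition dependence_support :: "nat \<Rightarrow> (nat \<Rightarrow> 'a::zero) \<Rightarrow> nat set" where
  "dependence_support l \<alpha> = {i\<in>{1..l}. \<alpha> i \<noteq> 0}"

definition irredundant_dependence ::
  "'a::semiring_1 set \<Rightarrow> nat \<Rightarrow> (nat \<Rightarrow> 'a ^ 'n) \<Rightarrow> 'a ^ 'n \<Rightarrow> 'a \<Rightarrow> (nat \<Rightarrow> 'a) \<Rightarrow> bool" where
  "irredundant_dependence G0 l w v a \<alpha> \<longleftrightarrow>
     tropical_dependence G0 l w v a \<alpha>
     \<and> (\<forall>b \<beta>. tropical_dependence G0 l w v b \<beta> \<longrightarrow>
           \<not> dependence_support l \<beta> \<subset> dependence_support l \<alpha>)"

definition saturated_dependence ::
  "'a::semiring_1 set \<Rightarrow> ('a \<Rightarrow> 'a) \<Rightarrow> nat \<Rightarrow> (nat \<Rightarrow> 'a ^ 'n) \<Rightarrow> 'a ^ 'n \<Rightarrow> (nat \<Rightarrow> 'a) \<Rightarrow> bool"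
where
  "saturated_dependence G0 \<nu> l w v \<alpha> \<longleftrightarrow>
     (\<forall>i\<in>{1..l}. \<alpha> i \<in> tangibles0 G0)
     \<and> v + (\<Sum>i=1..l. \<alpha> i *s w i) \<in> ghost_vectors G0
     \<and> (\<forall>\<beta>. (\<forall>i\<in>{1..l}. \<beta> i \<in> tangibles0 G0)
            \<and> v + (\<Sum>i=1..l. \<beta> i *s w i) \<in> ghost_vectors G0
          \<longrightarrow> (\<forall>i\<in>{1..l}. nu_le \<nu> (\<beta> i) (\<alpha> i)))"

end

theory Submission imports Defs begin

text \<open>
  Give \<open>v\<close> the coefficient \<open>1\<close> and treat it as one more member of the family, so that a
  dependence becomes a tuple of coefficients for which the sum in every coordinate is a ghost. Such
  a sum is a ghost exactly when it is zero, or its \<open>\<nu>\<close>-largest term is a ghost, or the largest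
  value occurs at least twice. Three facts carry the theorem.

  The pointwise maximum of two dependences is a dependence (\<open>ghost_sum_join\<close>). Hence a
  \<open>\<nu>\<close>-maximal dependence is automatically the greatest one, and it remains to show that a maximal
  one exists although the value group need not be complete, nor even densely ordered.

  A dependence can be enlarged until it is determined by finite data. Fix the coefficients on a set
  \<open>K\<close> containing the index of \<open>v\<close>, and multiply all the others by a common tangible factor
  \<open>t \<ge> 1\<close>. The sum stays a ghost until, in some coordinate, the part outside \<open>K\<close> catches up with
  the part inside \<open>K\<close>. If this never happens, the part outside \<open>K\<close> is already a ghost in all
  coordinates, contrary to the independence of \<open>S\<close>. So a smallest critical \<open>t\<close> exists, and there
  a term outside \<open>K\<close> ties with a term inside \<open>K\<close> (\<open>admissible_raise_to_tie\<close>).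

  A tie expresses the value of a new coefficient through the value of an old one and two entries of
  the vectors, so for a finite set of old values there are finitely many new ones. Adding the new
  index to \<open>K\<close> and repeating, every dependence lies below one whose values come from a fixed finite
  set (\<open>admissible_finite_cofinal\<close>). Among those a maximal one exists, which is the saturated
  dependence. Uniqueness is antisymmetry of the order on \<open>\<nu>\<close>-values.
\<close>

section \<open>The order by ghost values\<close>

context supertropical_semifield
begin

abbreviation nu_leq (infix "\<lesssim>" 50) where "a \<lesssim> b \<equiv> nu_le \<nu> a b"

lemma nu_zero: "\<nu> 0 = 0"
  by (simp add: nu_eq)

lemma nu_eq_zero_iff: "\<nu> a = 0 \<longleftrightarrow> a = 0"
  using add_nonzero[of a a] by (auto simp: nu_eq)

lemma nu_le_refl: "a \<lesssim> a"
  using nu_eq[of "\<nu> a"] by (simp add: nu_le_def nu_idem)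

lemma nu_le_of_eq: "\<nu> a = \<nu> b \<Longrightarrow> a \<lesssim> b"
  using nu_le_refl[of a] by (simp add: nu_le_def)

lemma nu_le_antisym: "a \<lesssim> b \<Longrightarrow> b \<lesssim> a \<Longrightarrow> \<nu> a = \<nu> b"
  by (simp add: nu_le_def add.commute)

lemma nu_le_trans: "a \<lesssim> b \<Longrightarrow> b \<lesssim> c \<Longrightarrow> a \<lesssim> c"
  unfolding nu_le_def by (metis add.assoc)

lemma zero_nu_le: "0 \<lesssim> a"
  by (simp add: nu_le_def nu_zero)

lemma nu_le_total: "a \<lesssim> b \<or> b \<lesssim> a"
proof (cases "a = 0 \<or> b = 0 \<or> \<nu> a = \<nu> b")
  case True
  then show ?thesis using zero_nu_le nu_le_of_eq by blast
next
  case False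
  then have "a + b \<in> {a, b}" using add_nu_neq by blast
  then have "\<nu> (a + b) = \<nu> a \<or> \<nu> (a + b) = \<nu> b" by auto
  then show ?thesis by (auto simp: nu_le_def nu_add add.commute)
qed

lemma nu_le_mult_left: "a \<lesssim> b \<Longrightarrow> c * a \<lesssim> c * b"
  by (simp add: nu_le_def nu_mult distrib_left[symmetric])

lemma nu_le_mult_right: "a \<lesssim> b \<Longrightarrow> a * c \<lesssim> b * c"
  by (simp add: nu_le_def nu_mult distrib_right[symmetric])

lemma nu_le_add_mono: "a \<lesssim> b \<Longrightarrow> c \<lesssim> d \<Longrightarrow> a + c \<lesssim> b + d"
proof -
  assume *: "a \<lesssim> b" "c \<lesssim> d"
  have "\<nu> (a + c) + \<nu> (b + d) = (\<nu> a + \<nu> b) + (\<nu> c + \<nu> d)"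
    by (simp add: nu_add ac_simps)
  then show ?thesis using * by (simp add: nu_le_def nu_add)
qed

lemma nu_le_sum_mono: "(\<And>i. i \<in> A \<Longrightarrow> f i \<lesssim> g i) \<Longrightarrow> sum f A \<lesssim> sum g A"
  by (induction A rule: infinite_finite_induct) (auto intro: nu_le_add_mono nu_le_refl)

section \<open>When a sum is a ghost\<close>

lemma add_absorb:
  assumes "a \<lesssim> b" "\<not> b \<lesssim> a"
  shows "a + b = b"
proof (cases "a = 0")
  case False
  have "b \<noteq> 0" using assms zero_nu_le by auto
  moreover have "\<nu> a \<noteq> \<nu> b" using assms nu_le_of_eq by metis
  ultimately have "a + b \<in> {a, b}" using False add_nu_neq by blast
  moreover have "a + b \<noteq> a" using assms by (metis nu_le_def nu_add add.commute)
  ultimately show ?thesis by blast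
qed simp

lemma add_tie:
  assumes "\<nu> a = \<nu> b"
  shows "a + b = \<nu> a"
proof (cases "a = 0")
  case True
  then have "b = 0" using assms nu_zero nu_eq_zero_iff by metis
  then show ?thesis using True nu_zero by simp
next
  case False
  then have "b \<noteq> 0" using assms nu_eq_zero_iff by metis
  then show ?thesis using False assms add_nu_eq by blast
qed

lemma ghost_add_absorb:
  assumes "b \<in> G0" "a \<lesssim> b"
  shows "a + b \<in> G0"
proof (cases "b \<lesssim> a")
  case True
  then have "a + b = \<nu> a" using add_tie nu_le_antisym assms(2) by blast
  then show ?thesis using nu_ghost by simp
next
  case False
  then show ?thesis using add_absorb assms by simp
qed

lemma nu_sum_attained:
  assumes "finite A" "sum f A \<noteq> 0"
  shows "\<exists>i\<in>A. \<nu> (sum f A) = \<nu> (f i)"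
  using assms
proof (induction A rule: finite_induct)
  case (insert x A)
  show ?case
  proof (cases "sum f A = 0")
    case True
    then show ?thesis using insert by simp
  next
    case False
    then obtain i where i: "i \<in> A" "\<nu> (sum f A) = \<nu> (f i)" using insert.IH by blast
    have "\<nu> (f x + sum f A) = \<nu> (f x) \<or> \<nu> (f x + sum f A) = \<nu> (sum f A)"
      using nu_le_total[of "f x" "sum f A"] by (auto simp: nu_le_def nu_add add.commute)
    then show ?thesis using insert i by auto
  qed
qed simp

lemma finite_has_nu_least:
  assumes "finite A" "A \<noteq> {}"
  shows "\<exists>m\<in>A. \<forall>x\<in>A. f m \<lesssim> f x"
  using assms
proof (induction A rule: finite_ne_induct)
  case (singleton x)
  then show ?case by (simp add: nu_le_refl)
next
  case (insert x A)
  then obtain m where m: "m \<in> A" "\<forall>y\<in>A. f m \<lesssim> f y" by blast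
  show ?case
    using nu_le_total[of "f m" "f x"] m nu_le_trans nu_le_refl by blast
qed

section \<open>Division up to ghost values\<close>

lemma nu_tangible_representative:
  assumes "a \<noteq> 0"
  obtains t where "t \<in> tangibles G0" "\<nu> t = \<nu> a"
proof -
  have "\<nu> a \<in> G0 - {0}" using assms nu_ghost nu_eq_zero_iff by blast
  then show thesis using nu_onto that by (metis imageE)
qed

lemma nu_inverse:
  assumes "a \<noteq> 0"
  obtains b where "b \<noteq> 0" "\<nu> a * \<nu> b = \<nu> 1" "\<nu> b * \<nu> a = \<nu> 1"
proof -
  obtain t where t: "t \<in> tangibles G0" "\<nu> t = \<nu> a"
    using nu_tangible_representative assms by blast
  then obtain b where b: "b \<in> tangibles G0" "t * b = 1" "b * t = 1"
    using tangible_inverse by blast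
  have "b \<noteq> 0" using b by auto
  moreover have "\<nu> a * \<nu> b = \<nu> 1" "\<nu> b * \<nu> a = \<nu> 1"
    using b t nu_mult by metis+
  ultimately show thesis using that by blast
qed

lemma nu_mult_right_cancel:
  assumes "c \<noteq> 0" "\<nu> (a * c) = \<nu> (b * c)"
  shows "\<nu> a = \<nu> b"
proof -
  obtain d where d: "\<nu> c * \<nu> d = \<nu> 1" using nu_inverse assms(1) by blast
  have "\<nu> x = \<nu> (x * c) * \<nu> d" for x
    by (metis d mult.assoc mult.right_neutral nu_mult)
  then show ?thesis using assms(2) by metis
qed

text \<open>
  Every ghost value is the value of a tangible element, so the quotient can be chosen tangible and
  may be used as a scaling factor for tangible coefficients.
\<close>

lemma nu_left_quotient:
  assumes "a \<noteq> 0" "b \<noteq> 0"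
  obtains t where "t \<in> tangibles G0" "\<nu> (t * a) = \<nu> b"
proof -
  obtain c where c: "c \<noteq> 0" "\<nu> c * \<nu> a = \<nu> 1" using nu_inverse assms(1) by blast
  obtain t where t: "t \<in> tangibles G0" "\<nu> t = \<nu> (b * c)"
    using nu_tangible_representative mult_nonzero assms(2) c(1) by blast
  have "\<nu> (t * a) = \<nu> b * (\<nu> c * \<nu> a)" by (simp add: nu_mult t mult.assoc)
  also have "\<dots> = \<nu> b" by (metis c(2) mult.right_neutral nu_mult)
  finally show thesis using that t by blast
qed

lemma tangible_nonzero: "a \<in> tangibles G0 \<Longrightarrow> a \<noteq> 0"
  using zero_ghost by (auto simp: tangibles_def)

section \<open>The maximum of two dependences\<close>

text \<open>
  Both summands are the larger ones in their sums: if \<open>p\<close> dominates \<open>q'\<close>, then it dominates \<open>q\<close>, so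
  \<open>p + q'\<close> and \<open>p + q\<close> are both equal to \<open>p\<close>. The case that \<open>q'\<close> dominates is symmetric, and in a
  tie the sum is a ghost anyway.
\<close>

lemma ghost_exchange:
  assumes "p + q \<in> G0" "p' + q' \<in> G0" "p' \<lesssim> p" "q \<lesssim> q'"
  shows "p + q' \<in> G0"
proof -
  consider "q' \<lesssim> p" "\<not> p \<lesssim> q'" | "p \<lesssim> q'" "\<not> q' \<lesssim> p" | "\<nu> p = \<nu> q'"
    using nu_le_total nu_le_antisym by blast
  then show ?thesis
  proof cases
    case 1
    then have "q + p = p" "q' + p = p" using assms nu_le_trans add_absorb by blast+
    then show ?thesis using assms(1) by (simp add: add.commute)
  next
    case 2
    then have "p' + q' = q'" "p + q' = q'" using assms nu_le_trans add_absorb by blast+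
    then show ?thesis using assms(2) by simp
  next
    case 3
    then show ?thesis using add_tie nu_ghost by simp
  qed
qed

text \<open>
  Split the indices by which of the two coefficients is larger, and exchange the two partial sums.
\<close>

lemma ghost_sum_join:
  assumes I: "finite I"
    and c: "(\<Sum>i\<in>I. c i * x i) \<in> G0" and d: "(\<Sum>i\<in>I. d i * x i) \<in> G0"
  shows "(\<Sum>i\<in>I. (if d i \<lesssim> c i then c i else d i) * x i) \<in> G0"
proof -
  define B where "B = {i\<in>I. d i \<lesssim> c i}"
  define A where "A = {i\<in>I. \<not> d i \<lesssim> c i}"
  have split: "sum f I = sum f B + sum f A" for f :: "_ \<Rightarrow> 'a"
    unfolding A_def B_def
    using I by (subst sum.union_disjoint[symmetric]) (auto intro: sum.cong)
  have "(\<Sum>i\<in>B. c i * x i) + (\<Sum>i\<in>A. d i * x i) \<in> G0"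
  proof (rule ghost_exchange)
    show "(\<Sum>i\<in>B. c i * x i) + (\<Sum>i\<in>A. c i * x i) \<in> G0" using c split by metis
    show "(\<Sum>i\<in>B. d i * x i) + (\<Sum>i\<in>A. d i * x i) \<in> G0" using d split by metis
    show "(\<Sum>i\<in>B. d i * x i) \<lesssim> (\<Sum>i\<in>B. c i * x i)"
      by (rule nu_le_sum_mono) (auto simp: B_def intro: nu_le_mult_right)
    show "(\<Sum>i\<in>A. c i * x i) \<lesssim> (\<Sum>i\<in>A. d i * x i)"
      by (rule nu_le_sum_mono) (use nu_le_total in \<open>auto simp: A_def intro: nu_le_mult_right\<close>)
  qed
  also have "(\<Sum>i\<in>B. c i * x i) + (\<Sum>i\<in>A. d i * x i)
      = (\<Sum>i\<in>I. (if d i \<lesssim> c i then c i else d i) * x i)"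
    unfolding split by (intro arg_cong2[of _ _ _ _ "(+)"] sum.cong) (auto simp: A_def B_def)
  finally show ?thesis .
qed

section \<open>Raising a dependence to a tie\<close>

text \<open>
  The dependences of \<open>u z\<close> on the other vectors of the family with full support, normalised at the
  distinguished index \<open>z\<close>.
\<close>

definition admissible :: "'i set \<Rightarrow> 'i \<Rightarrow> ('i \<Rightarrow> 'a ^ 'n) \<Rightarrow> ('i \<Rightarrow> 'a) \<Rightarrow> bool" where
  "admissible I z u c \<longleftrightarrow>
     c z = 1 \<and> (\<forall>i\<in>I. c i \<in> tangibles G0) \<and> (\<forall>j. (\<Sum>i\<in>I. c i * u i $ j) \<in> G0)"

text \<open>
  Write \<open>p j\<close> and \<open>q j\<close> for the parts of the sum in coordinate \<open>j\<close> inside and outside \<open>K\<close>, and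
  suppose that no two of them tie. Where \<open>q j\<close> dominates it is a ghost itself and remains dominant
  when scaled up. Where \<open>p j\<close> dominates a nonzero \<open>q j\<close>, \<open>p j\<close> is a ghost, and the sum stays one as
  long as the scaled \<open>q j\<close> does not exceed \<open>p j\<close>. Coordinates of the second kind exist, for
  otherwise all \<open>q j\<close> would be ghosts; the smallest of their quotients \<open>p j / q j\<close> is the largest
  factor that respects all of them, and it produces a tie.

  The scaling acts on the left of the coefficients, so it factors out of the sum even when the
  multiplication does not commute.
\<close>

lemma admissible_raise_to_tie:
  fixes u :: "'i \<Rightarrow> 'a ^ 'n"
  assumes adm: "admissible I z u c" and I: "finite I"
    and K: "K \<subset> I" "z \<in> K"
    and indep: "\<And>b. \<forall>i\<in>I - K. b i \<in> tangibles G0 \<Longrightarrow>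
                  \<exists>j. (\<Sum>i\<in>I - K. b i * u i $ j) \<notin> G0"
  obtains d i k j where "admissible I z u d" "\<forall>i\<in>I. c i \<lesssim> d i" "\<forall>i\<in>K. d i = c i"
    "i \<in> I - K" "k \<in> K" "u i $ j \<noteq> 0" "\<nu> (d i * u i $ j) = \<nu> (d k * u k $ j)"
proof -
  define tie where "tie b j \<longleftrightarrow> (\<Sum>i\<in>I - K. b i * u i $ j) \<noteq> 0 \<and>
      \<nu> (\<Sum>i\<in>I - K. b i * u i $ j) = \<nu> (\<Sum>i\<in>K. b i * u i $ j)" for b j
  have fin: "finite K" "finite (I - K)" using I K finite_subset by blast+
  have split: "sum f I = sum f K + sum f (I - K)" for f :: "_ \<Rightarrow> 'a"
    using I K by (metis add.commute psubset_imp_subset sum.subset_diff)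
  have tie_terms: "\<exists>i\<in>I - K. \<exists>k\<in>K. u i $ j \<noteq> 0 \<and> \<nu> (b i * u i $ j) = \<nu> (b k * u k $ j)"
    if "tie b j" for b j
  proof -
    let ?q = "\<Sum>i\<in>I - K. b i * u i $ j" and ?p = "\<Sum>i\<in>K. b i * u i $ j"
    have q: "?q \<noteq> 0" "\<nu> ?q = \<nu> ?p" using that by (auto simp: tie_def)
    then have p: "?p \<noteq> 0" using nu_eq_zero_iff by metis
    obtain i where i: "i \<in> I - K" "\<nu> ?q = \<nu> (b i * u i $ j)"
      using nu_sum_attained[OF fin(2) q(1)] by blast
    moreover obtain k where "k \<in> K" "\<nu> ?p = \<nu> (b k * u k $ j)"
      using nu_sum_attained[OF fin(1) p] by blast
    moreover have "u i $ j \<noteq> 0" using i q(1) nu_eq_zero_iff by (metis mult_zero_right)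
    ultimately show ?thesis using q(2) by metis
  qed
  show thesis
  proof (cases "\<exists>j. tie c j")
    case True
    then obtain j i k where "i \<in> I - K" "k \<in> K" "u i $ j \<noteq> 0"
        "\<nu> (c i * u i $ j) = \<nu> (c k * u k $ j)"
      using tie_terms by blast
    then show thesis using that[of c] adm nu_le_refl by blast
  next
    case no_tie: False
    define p where "p j = (\<Sum>i\<in>K. c i * u i $ j)" for j
    define q where "q j = (\<Sum>i\<in>I - K. c i * u i $ j)" for j
    have pq: "p j + q j \<in> G0" for j
      using adm split unfolding p_def q_def admissible_def by metis
    have neq: "\<nu> (q j) \<noteq> \<nu> (p j)" if "q j \<noteq> 0" for j
      using no_tie that by (auto simp: tie_def p_def q_def)
    \<comment> \<open>The coordinates that limit the scaling.\<close>
    define J where "J = {j. q j \<noteq> 0 \<and> q j \<lesssim> p j}"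
    have q_ghost: "q j \<in> G0" if "j \<notin> J" for j
    proof (cases "q j = 0")
      case False
      then have "\<not> q j \<lesssim> p j" using that by (simp add: J_def)
      then show ?thesis using nu_le_total add_absorb pq by metis
    qed (simp add: zero_ghost)
    have p_ghost: "p j \<in> G0" and less: "\<not> p j \<lesssim> q j" if "j \<in> J" for j
    proof -
      show *: "\<not> p j \<lesssim> q j" using that neq nu_le_antisym by (auto simp: J_def)
      then have "q j + p j = p j" using that add_absorb by (auto simp: J_def)
      then show "p j \<in> G0" using pq[of j] by (simp add: add.commute)
    qed
    have "J \<noteq> {}"
      using indep[of c] adm q_ghost K by (auto simp: admissible_def q_def)
    have "\<exists>t\<in>tangibles G0. \<nu> (t * q j) = \<nu> (p j)" if "j \<in> J" for j
    proof -
      have "p j \<noteq> 0" using less[OF that] zero_nu_le by auto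
      then show ?thesis using nu_left_quotient[of "q j" "p j"] that by (auto simp: J_def)
    qed
    then obtain s where s: "\<And>j. j \<in> J \<Longrightarrow> s j \<in> tangibles G0"
        "\<And>j. j \<in> J \<Longrightarrow> \<nu> (s j * q j) = \<nu> (p j)"
      by metis
    obtain j where j: "j \<in> J" "\<And>j'. j' \<in> J \<Longrightarrow> s j \<lesssim> s j'"
      using finite_has_nu_least[of J s] \<open>J \<noteq> {}\<close> by auto
    define d where "d i = (if i \<in> K then c i else s j * c i)" for i
    have one_le: "1 \<lesssim> s j"
    proof (rule ccontr)
      assume "\<not> 1 \<lesssim> s j"
      then have "s j * q j \<lesssim> 1 * q j" using nu_le_total nu_le_mult_right by blast
      then show False using s(2)[OF j(1)] less[OF j(1)] by (simp add: nu_le_def)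
    qed
    have d_K: "(\<Sum>i\<in>K. d i * u i $ j') = p j'" for j'
      by (simp add: d_def p_def)
    have d_free: "(\<Sum>i\<in>I - K. d i * u i $ j') = s j * q j'" for j'
      unfolding q_def sum_distrib_left by (rule sum.cong) (auto simp: d_def mult.assoc)
    have "p j' + s j * q j' \<in> G0" for j'
    proof (cases "j' \<in> J")
      case True
      have "s j * q j' \<lesssim> s j' * q j'" using j(2) True nu_le_mult_right by blast
      then have "s j * q j' \<lesssim> p j'" using s(2)[OF True] by (simp add: nu_le_def)
      then show ?thesis using ghost_add_absorb p_ghost True by (metis add.commute)
    next
      case False
      have q: "s j * q j' \<in> G0" using q_ghost False mult_ghost_left by blast
      show ?thesis
      proof (cases "q j' = 0")
        case True
        then show ?thesis using pq[of j'] by simp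
      next
        case False
        then have "p j' \<lesssim> q j'" using \<open>j' \<notin> J\<close> nu_le_total by (auto simp: J_def)
        moreover have "q j' \<lesssim> s j * q j'" using nu_le_mult_right[OF one_le] by force
        ultimately show ?thesis using ghost_add_absorb q nu_le_trans by blast
      qed
    qed
    then have "admissible I z u d"
      using adm K s(1) j(1) mult_tangible d_K d_free
      by (auto simp: admissible_def split d_def)
    moreover have "\<forall>i\<in>I. c i \<lesssim> d i"
      using nu_le_mult_right[OF one_le] nu_le_refl by (force simp: d_def)
    moreover have "\<forall>i\<in>K. d i = c i" by (simp add: d_def)
    moreover have "tie d j"
      using j(1) s mult_nonzero tangible_nonzero by (auto simp: tie_def d_K d_free J_def)
    ultimately show thesis using that tie_terms by blast
  qed
qed

section \<open>Finitely many values suffice\<close>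

text \<open>
  The induction is on the number of indices whose coefficients are already confined to a finite set
  of values. That set depends only on the vectors and the number of steps, since it has to serve
  all \<open>c\<close> at once. One step either has nothing left to do or adds an index by a tie.
\<close>

lemma admissible_finite_cofinal:
  fixes u :: "'i \<Rightarrow> 'a ^ 'n"
  assumes I: "finite I" "z \<in> I"
    and indep: "\<And>C b. C \<subseteq> I - {z} \<Longrightarrow> C \<noteq> {} \<Longrightarrow> \<forall>i\<in>C. b i \<in> tangibles G0 \<Longrightarrow>
                  \<exists>j. (\<Sum>i\<in>C. b i * u i $ j) \<notin> G0"
  obtains X where "finite X"
    "\<And>c. admissible I z u c \<Longrightarrow>
       \<exists>d. admissible I z u d \<and> (\<forall>i\<in>I. c i \<lesssim> d i) \<and> (\<forall>i\<in>I. \<nu> (d i) \<in> X)"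
proof -
  have "\<exists>X. finite X \<and> (\<forall>c. admissible I z u c \<longrightarrow>
      (\<exists>d K. admissible I z u d \<and> (\<forall>i\<in>I. c i \<lesssim> d i) \<and> K \<subseteq> I \<and> z \<in> K \<and>
        (m \<le> card K \<or> K = I) \<and> (\<forall>i\<in>K. \<nu> (d i) \<in> X)))" for m
  proof (induction m)
    case 0
    show ?case
    proof (intro exI[of _ "{\<nu> 1}"] conjI allI impI)
      fix c assume "admissible I z u c"
      then show "\<exists>d K. admissible I z u d \<and> (\<forall>i\<in>I. c i \<lesssim> d i) \<and> K \<subseteq> I \<and> z \<in> K \<and>
          (0 \<le> card K \<or> K = I) \<and> (\<forall>i\<in>K. \<nu> (d i) \<in> {\<nu> 1})"
        using I(2) nu_le_refl by (intro exI[of _ c] exI[of _ "{z}"]) (auto simp: admissible_def)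
    qed simp
  next
    case (Suc m)
    then obtain X where X: "finite X" and reach: "\<And>c. admissible I z u c \<Longrightarrow>
        \<exists>d K. admissible I z u d \<and> (\<forall>i\<in>I. c i \<lesssim> d i) \<and> K \<subseteq> I \<and> z \<in> K \<and>
          (m \<le> card K \<or> K = I) \<and> (\<forall>i\<in>K. \<nu> (d i) \<in> X)"
      by blast
    \<comment> \<open>\<open>Y (x, i, k, j)\<close> has at most one element: the value that index \<open>i\<close> must have in order to tie in
        coordinate \<open>j\<close> with index \<open>k\<close>, when the latter has the value \<open>x\<close>.\<close>
    define Y where "Y = (\<lambda>(x, i, k, j). {\<nu> a | a. u i $ j \<noteq> 0 \<and> \<nu> (a * u i $ j) = x * \<nu> (u k $ j)})"
    have "finite (Y s)" for s
    proof -
      obtain x i k j where s: "s = (x, i, k, j)" by (cases s)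
      have "y = y'" if y: "y \<in> Y s" "y' \<in> Y s" for y y'
      proof -
        obtain a where "y = \<nu> a" "u i $ j \<noteq> 0" "\<nu> (a * u i $ j) = x * \<nu> (u k $ j)"
          using y(1) by (auto simp: Y_def s)
        moreover obtain a' where "y' = \<nu> a'" "\<nu> (a' * u i $ j) = x * \<nu> (u k $ j)"
          using y(2) by (auto simp: Y_def s)
        ultimately show ?thesis using nu_mult_right_cancel by metis
      qed
      then have "Y s \<subseteq> {y}" if "y \<in> Y s" for y using that by blast
      then show ?thesis by (metis all_not_in_conv finite.emptyI finite_insert finite_subset)
    qed
    then have finite: "finite (X \<union> (\<Union>s\<in>X \<times> I \<times> I \<times> UNIV. Y s))"
      using X I by (intro finite_UnI finite_UN_I finite_cartesian_product) auto
    show ?case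
    proof (intro exI[of _ "X \<union> (\<Union>s\<in>X \<times> I \<times> I \<times> UNIV. Y s)"] conjI allI impI finite)
      fix c assume "admissible I z u c"
      then obtain d K where d: "admissible I z u d" "\<forall>i\<in>I. c i \<lesssim> d i"
          and K: "K \<subseteq> I" "z \<in> K" "m \<le> card K \<or> K = I" "\<forall>i\<in>K. \<nu> (d i) \<in> X"
        using reach by blast
      show "\<exists>d K. admissible I z u d \<and> (\<forall>i\<in>I. c i \<lesssim> d i) \<and> K \<subseteq> I \<and> z \<in> K \<and>
          (Suc m \<le> card K \<or> K = I) \<and> (\<forall>i\<in>K. \<nu> (d i) \<in> X \<union> (\<Union>s\<in>X \<times> I \<times> I \<times> UNIV. Y s))"
      proof (cases "K = I")
        case True
        then show ?thesis using d K by (intro exI[of _ d] exI[of _ K]) auto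
      next
        case False
        then have less: "K \<subset> I" using K by blast
        have free: "\<exists>j. (\<Sum>i\<in>I - K. b i * u i $ j) \<notin> G0"
          if "\<forall>i\<in>I - K. b i \<in> tangibles G0" for b
          using indep[of "I - K" b] that K less by blast
        obtain e i k j where e: "admissible I z u e" "\<forall>i\<in>I. d i \<lesssim> e i"
            "\<forall>i\<in>K. e i = d i"
            and tie: "i \<in> I - K" "k \<in> K" "u i $ j \<noteq> 0" "\<nu> (e i * u i $ j) = \<nu> (e k * u k $ j)"
          using admissible_raise_to_tie[OF d(1) I(1) less K(2) free] by blast
        have "\<nu> (e i) \<in> Y (\<nu> (d k), i, k, j)"
          using tie e(3) by (auto simp: Y_def nu_mult)
        moreover have "(\<nu> (d k), i, k, j) \<in> X \<times> I \<times> I \<times> UNIV"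
          using tie K by auto
        ultimately have "\<nu> (e i) \<in> (\<Union>s\<in>X \<times> I \<times> I \<times> UNIV. Y s)" by blast
        moreover have "Suc m \<le> card (insert i K)"
          using K False tie(1) I(1) finite_subset[OF K(1)] by simp
        moreover have "\<forall>i\<in>I. c i \<lesssim> e i" using d(2) e(2) nu_le_trans by blast
        ultimately show ?thesis
          using e(1,3) K tie(1) by (intro exI[of _ e] exI[of _ "insert i K"]) auto
      qed
    qed
  qed
  from this[of "card I"] obtain X where "finite X" and X: "\<And>c. admissible I z u c \<Longrightarrow>
      \<exists>d K. admissible I z u d \<and> (\<forall>i\<in>I. c i \<lesssim> d i) \<and> K \<subseteq> I \<and> z \<in> K \<and>
        (card I \<le> card K \<or> K = I) \<and> (\<forall>i\<in>K. \<nu> (d i) \<in> X)"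
    by blast
  show thesis
  proof (rule that[OF \<open>finite X\<close>])
    fix c assume "admissible I z u c"
    from X[OF this] obtain d K where d: "admissible I z u d" "\<forall>i\<in>I. c i \<lesssim> d i"
        and K: "K \<subseteq> I" "card I \<le> card K \<or> K = I" "\<forall>i\<in>K. \<nu> (d i) \<in> X"
      by (elim exE conjE)
    have "K = I" using K(1,2) card_seteq[OF I(1)] by blast
    then show "\<exists>d. admissible I z u d \<and> (\<forall>i\<in>I. c i \<lesssim> d i) \<and> (\<forall>i\<in>I. \<nu> (d i) \<in> X)"
      using d K(3) by blast
  qed
qed

section \<open>The greatest dependence\<close>

text \<open>
  The competitors \<open>b\<close> are allowed to have zero coefficients. The maximum of \<open>b\<close> with a tangible
  tuple is tangible again, so it is admissible and can be raised into the finite set of values.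
\<close>

lemma admissible_greatest:
  fixes u :: "'i \<Rightarrow> 'a ^ 'n"
  assumes I: "finite I" "z \<in> I"
    and indep: "\<And>C b. C \<subseteq> I - {z} \<Longrightarrow> C \<noteq> {} \<Longrightarrow> \<forall>i\<in>C. b i \<in> tangibles G0 \<Longrightarrow>
                  \<exists>j. (\<Sum>i\<in>C. b i * u i $ j) \<notin> G0"
    and ex: "admissible I z u a"
  obtains c where "admissible I z u c"
    "\<And>b i. b z = 1 \<Longrightarrow> \<forall>i\<in>I. b i \<in> tangibles0 G0 \<Longrightarrow>
       \<forall>j. (\<Sum>i\<in>I. b i * u i $ j) \<in> G0 \<Longrightarrow> i \<in> I \<Longrightarrow> b i \<lesssim> c i"
proof -
  obtain X where X: "finite X" and cofinal: "\<And>c. admissible I z u c \<Longrightarrow>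
      \<exists>d. admissible I z u d \<and> (\<forall>i\<in>I. c i \<lesssim> d i) \<and> (\<forall>i\<in>I. \<nu> (d i) \<in> X)"
    using admissible_finite_cofinal[OF I indep] by blast
  \<comment> \<open>Counting the values below each coefficient turns the order on tuples with values in \<open>X\<close> into a
      bounded number that grows strictly with the tuple, so its maximum picks a maximal tuple.\<close>
  define below where "below c i = {x \<in> X. x + \<nu> (c i) = \<nu> (c i)}" for c :: "'i \<Rightarrow> 'a" and i
  define height where "height c = (\<Sum>i\<in>I. card (below c i))" for c
  define D where "D = {d. admissible I z u d \<and> (\<forall>i\<in>I. \<nu> (d i) \<in> X)}"
  have fin_below: "finite (below c i)" for c i using X by (simp add: below_def)
  have "height d \<le> (\<Sum>i\<in>I. card X)" for d
    unfolding height_def by (rule sum_mono) (auto simp: below_def intro: card_mono X)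
  moreover have "D \<noteq> {}" using cofinal[OF ex] by (auto simp: D_def)
  ultimately obtain c where c: "c \<in> D" "\<And>d. d \<in> D \<Longrightarrow> height d \<le> height c"
    using ex_has_greatest_nat[of "\<lambda>d. d \<in> D" _ height "Suc (\<Sum>i\<in>I. card X)"]
    by (metis ex_in_conv less_Suc_eq_le)
  have below_mono: "below d i \<subseteq> below e i" if "d i \<lesssim> e i" for d e i
    using that unfolding below_def nu_le_def by (auto, metis add.assoc)
  have "b i \<lesssim> c i" if b: "b z = 1" "\<forall>i\<in>I. b i \<in> tangibles0 G0"
      "\<forall>j. (\<Sum>i\<in>I. b i * u i $ j) \<in> G0" and i: "i \<in> I" for b i
  proof -
    define m where "m i = (if b i \<lesssim> c i then c i else b i)" for i
    have "m i \<in> tangibles G0" if "i \<in> I" for i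
      using that b(2) c(1) zero_nu_le by (auto simp: m_def D_def admissible_def tangibles0_def)
    then have "admissible I z u m"
      using b c(1) ghost_sum_join[OF I(1)]
      by (auto simp: admissible_def D_def m_def)
    then obtain d where d: "d \<in> D" "\<forall>i\<in>I. m i \<lesssim> d i"
      using cofinal[of m] unfolding D_def by blast
    have m: "b i \<lesssim> m i" "c i \<lesssim> m i" for i
      using nu_le_total nu_le_refl by (auto simp: m_def)
    have cd: "c i \<lesssim> d i" if "i \<in> I" for i using d(2) m(2) nu_le_trans that by blast
    have sub: "below c i \<subseteq> below d i" using below_mono cd i by blast
    have "card (below c i) = card (below d i)"
    proof (rule ccontr)
      assume "card (below c i) \<noteq> card (below d i)"
      then have "card (below c i) < card (below d i)"
        using card_mono[OF fin_below sub] by simp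
      moreover have "card (below c k) \<le> card (below d k)" if "k \<in> I" for k
        using card_mono[OF fin_below] below_mono cd that by metis
      ultimately have "height c < height d"
        unfolding height_def using I(1) i by (intro sum_strict_mono_ex1) auto
      then show False using c(2) d(1) by fastforce
    qed
    then have same: "below c i = below d i"
      using card_subset_eq[OF fin_below sub] by simp
    have "\<nu> (d i) \<in> below d i"
      using d(1) i nu_le_refl by (auto simp: D_def below_def nu_le_def)
    then have "\<nu> (d i) \<in> below c i" by (simp only: same)
    then have "d i \<lesssim> c i" by (simp add: below_def nu_le_def)
    then show ?thesis using m(1) d(2) i nu_le_trans by blast
  qed
  then show thesis using that[of c] c(1) by (simp add: D_def)
qed

end

theorem theorem4p18:
  fixes G0 :: "'a::semiring_1 set" and \<nu> :: "'a \<Rightarrow> 'a"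
    and v :: "'a ^ 'n" and w :: "nat \<Rightarrow> 'a ^ 'n" and l :: nat and \<alpha> :: "nat \<Rightarrow> 'a"
  assumes "supertropical_semifield G0 \<nu>"
    and "inj_on w {1..l}"
    and "tropically_independent G0 (w ` {1..l})"
    and "\<forall>i\<in>{1..l}. \<alpha> i \<in> tangibles G0"
    and "irredundant_dependence G0 l w v 1 \<alpha>"
  shows "\<exists>\<alpha>'. (\<forall>i\<in>{1..l}. \<alpha>' i \<in> tangibles G0 \<and> nu_le \<nu> (\<alpha> i) (\<alpha>' i))
           \<and> dependence_support l \<alpha>' = dependence_support l \<alpha>
           \<and> saturated_dependence G0 \<nu> l w v \<alpha>'
           \<and> (\<forall>\<alpha>''. saturated_dependence G0 \<nu> l w v \<alpha>'' \<longrightarrow>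
                 (\<forall>i\<in>{1..l}. tropical_equiv G0 \<nu> (\<alpha>'' i) (\<alpha>' i)))"
proof -
  interpret supertropical_semifield G0 \<nu> by fact
  define u where "u = w(0 := v)"
  have I: "{0..l} = insert 0 {1..l}" by auto
  have relation: "v + (\<Sum>i=1..l. b i *s w i) \<in> ghost_vectors G0 \<longleftrightarrow>
      (\<forall>j. (\<Sum>i\<in>{0..l}. (b(0 := 1)) i * u i $ j) \<in> G0)" for b
    unfolding I ghost_vectors_def by (simp add: u_def)
  have indep: "\<exists>j. (\<Sum>i\<in>C. b i * u i $ j) \<notin> G0"
    if C: "C \<subseteq> {0..l} - {0}" "C \<noteq> {}" and b: "\<forall>i\<in>C. b i \<in> tangibles G0" for C b
  proof (rule ccontr)
    assume ghost: "\<not> ?thesis"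
    have C': "C \<subseteq> {1..l}" using C by force
    then have inj: "inj_on w C" using assms(2) inj_on_subset by blast
    have inv: "the_inv_into C w (w i) = i" if "i \<in> C" for i
      using inj that by (rule the_inv_into_f_f)
    have "(\<Sum>x\<in>w ` C. b (the_inv_into C w x) *s x) = (\<Sum>i\<in>C. b i *s w i)"
      by (simp add: sum.reindex[OF inj] inv)
    also have "\<dots> = (\<Sum>i\<in>C. b i *s u i)"
      using C by (intro sum.cong) (auto simp: u_def)
    also have "\<dots> \<in> ghost_vectors G0" using ghost by (simp add: ghost_vectors_def)
    finally have "tropically_dependent G0 (w ` {1..l})"
      unfolding tropically_dependent_def using C(2) C' b inv finite_subset[OF C']
      by (intro exI[of _ "w ` C"] exI[of _ "\<lambda>x. b (the_inv_into C w x)"] conjI) auto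
    then show False using assms(3) by blast
  qed
  have "v + (\<Sum>i=1..l. \<alpha> i *s w i) \<in> ghost_vectors G0"
    using assms(5) by (simp add: irredundant_dependence_def tropical_dependence_def)
  then have "admissible {0..l} 0 u (\<alpha>(0 := 1))"
    unfolding relation admissible_def using assms(4) one_tangible by (auto simp: I)
  then obtain c where c: "admissible {0..l} 0 u c"
      and greatest: "\<And>b i. b 0 = 1 \<Longrightarrow> \<forall>i\<in>{0..l}. b i \<in> tangibles0 G0 \<Longrightarrow>
        \<forall>j. (\<Sum>i\<in>{0..l}. b i * u i $ j) \<in> G0 \<Longrightarrow> i \<in> {0..l} \<Longrightarrow> nu_le \<nu> (b i) (c i)"
  proof -
    have "finite {0..l}" "0 \<in> {0..l}" by auto
    from admissible_greatest[OF this indep \<open>admissible {0..l} 0 u (\<alpha>(0 := 1))\<close>] that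
    show thesis by blast
  qed
  have tang: "\<forall>i\<in>{1..l}. c i \<in> tangibles G0" using c by (auto simp: admissible_def)
  have c0: "c(0 := 1) = c" using c by (auto simp: admissible_def)
  have max: "nu_le \<nu> (b i) (c i)" if "\<forall>i\<in>{1..l}. b i \<in> tangibles0 G0"
      "v + (\<Sum>i=1..l. b i *s w i) \<in> ghost_vectors G0" "i \<in> {1..l}" for b i
    using greatest[of "b(0 := 1)" i] that one_tangible
    unfolding relation by (auto simp: tangibles0_def split: if_splits)
  have sat: "saturated_dependence G0 \<nu> l w v c"
  proof -
    have "v + (\<Sum>i=1..l. c i *s w i) \<in> ghost_vectors G0"
      unfolding relation c0 using c by (simp add: admissible_def)
    then show ?thesis
      unfolding saturated_dependence_def using tang max by (auto simp: tangibles0_def)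
  qed
  have "tropical_equiv G0 \<nu> (b i) (c i)"
    if b: "saturated_dependence G0 \<nu> l w v b" and i: "i \<in> {1..l}" for b i
  proof -
    have "nu_le \<nu> (b i) (c i)" "nu_le \<nu> (c i) (b i)"
      using b sat i by (auto simp: saturated_dependence_def)
    then have eq: "\<nu> (b i) = \<nu> (c i)" using nu_le_antisym by blast
    then have "b i \<noteq> 0" using tang i tangible_nonzero nu_zero nu_eq_zero_iff by metis
    then show ?thesis
      using b i eq tang by (auto simp: saturated_dependence_def tropical_equiv_def tangibles0_def)
  qed
  moreover have "\<forall>i\<in>{1..l}. nu_le \<nu> (\<alpha> i) (c i)"
    using max[of \<alpha>] assms(4) \<open>v + (\<Sum>i=1..l. \<alpha> i *s w i) \<in> ghost_vectors G0\<close>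
    by (auto simp: tangibles0_def)
  moreover have "dependence_support l c = dependence_support l \<alpha>"
    using tang assms(4) tangible_nonzero by (auto simp: dependence_support_def)
  ultimately show ?thesis using sat tang by blast
qed

end
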